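(* Let $B$ be the $N\times N$ real upper bidiagonal matrix with diagonal entries $B_{i,i}=\sqrt{q_i}$ ($i=1,\dots,N$), upper subdiagonal entries $B_{i,i+1}=\sqrt{e_i}$ ($i=1,\dots,N-1$), and all other entries zero, where $q_i>0$ for $i=1,\dots,N$ and $e_i>0$ for $i=1,\dots,N-1$. Define $$F_i=\frac{e_i}{q_i},\qquad i=1,\dots,N-1.$$ Let the constants $\tilde h_i^{(p)}$ ($i=1,\dots,N$, $p=1,2,\dots$) be given by the following recurrence relation. For $p=1$, $$\tilde h_N^{(1)}=\frac1{q_N},\qquad \tilde h_i^{(1)}=F_i\,\tilde h_{i+1}^{(1)}+\frac1{q_i},\quad i=1,\dots,N-1.$$ For $i=N$ and $p=2,3,\dots$, $$\tilde h_N^{(p)}=0.$$ For $i=1,\dots,N-1$ and $p=2,3,\dots$, $$\tilde h_i^{(p)}=F_i\left(\tilde h_{i+1}^{(p)}+p\,\tilde h_{i+1}^{(1)}\tilde h_{i+1}^{(p-1)}\right)+\sum_{k=1}^{p-2}\binom{p}{k}\tilde h_{i+1}^{(k)}\tilde h_i^{(p-k)}.$$ Let the constants $\tilde H_i^{(p)}$ ($i=1,\dots,N$, $p=1,2,\dots$) be given by $$\tilde H_i^{(1)}=\tilde h_i^{(1)},\qquad \tilde H_i^{(p)}=\tilde h_i^{(p)}+\sum_{k=1}^{p-1}\binom{p-1}{k}\tilde h_i^{(k)}\tilde H_i^{(p-k)},\quad p=2,3,\dots.$$ Then for every $p=1,2,\dots$, $$\mathrm{Tr}\left((BB^{\top})^{-p}\right)=\frac1{(p-1)!}\sum_{i=1}^{N}\tilde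 H_i^{(p)}.$$
   Context: Convention: $\sum_{i=j}^{k}=0$ if $j>k$. $\mathrm{Tr}$ denotes the trace, $B^\top$ the transpose, and $(BB^\top)^{-p}$ the $p$-th power of the inverse of $BB^\top$. *)

theory Defs
  imports Complex_Main "Jordan_Normal_Form.Gauss_Jordan_Elimination"
begin

(* The library's matrices are indexed from 0, whereas the sequences q and e are indexed from 1:
   the entry in row i + 1 and column j + 1 sits at position (i, j). *)
definition upper_bidiagonal :: "nat \<Rightarrow> (nat \<Rightarrow> real) \<Rightarrow> (nat \<Rightarrow> real) \<Rightarrow> real mat" where
  "upper_bidiagonal N q e = mat N N (\<lambda>(i, j).
     if j = i then sqrt (q (i + 1))
     else if j = i + 1 then sqrt (e (i + 1))
     else 0)"

definition mat_trace :: "'a :: comm_monoid_add mat \<Rightarrow> 'a" where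
  "mat_trace A = (\<Sum>i<dim_row A. A $$ (i, i))"

end

theory Submission
  imports Defs "HOL-Computational_Algebra.Formal_Power_Series" "Jordan_Normal_Form.Determinant"
begin

text \<open>
  Write \<open>A = B B\<^sup>T\<close>, \<open>C = A\<^sup>-\<^sup>1\<close> and \<open>g\<^sub>i = \<Sum>\<^sub>p h\<^sub>i\<^sup>(\<^sup>p\<^sup>) x\<^sup>p / p!\<close>. The recurrence for \<open>h\<close> says exactly that the
  matrix \<open>A - x I\<close> of formal power series factors as \<open>U L\<close> with \<open>U\<close> unit upper bidiagonal and \<open>L\<close>
  lower bidiagonal with diagonal entries \<open>q\<^sub>i (1 - g\<^sub>i)\<close>. Since \<open>(A - x I)\<^sup>-\<^sup>1 = \<Sum>\<^sub>p C\<^sup>p\<^sup>+\<^sup>1 x\<^sup>p\<close>,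
  differentiating the factorization gives
  \<open>\<Sum>\<^sub>p Tr (C\<^sup>p\<^sup>+\<^sup>1) x\<^sup>p = - Tr (U\<^sup>-\<^sup>1 U') - Tr (L\<^sup>-\<^sup>1 L') = \<Sum>\<^sub>i g\<^sub>i' / (1 - g\<^sub>i)\<close>,
  and the recurrence for \<open>H\<close> identifies the coefficients of \<open>g\<^sub>i' / (1 - g\<^sub>i)\<close>.
\<close>

section \<open>Traces and triangular matrices over commutative rings\<close>

lemma mat_trace_mult_comm:
  fixes A B :: "'a :: comm_semiring_0 mat"
  assumes "A \<in> carrier_mat m n" "B \<in> carrier_mat n m"
  shows "mat_trace (A * B) = mat_trace (B * A)"
proof -
  have "mat_trace (A * B) = (\<Sum>i<m. \<Sum>j<n. A $$ (i, j) * B $$ (j, i))"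
    using assms by (auto simp: mat_trace_def scalar_prod_def lessThan_atLeast0 intro!: sum.cong)
  also have "\<dots> = (\<Sum>j<n. \<Sum>i<m. B $$ (j, i) * A $$ (i, j))"
    by (subst sum.swap) (simp add: mult.commute)
  also have "\<dots> = mat_trace (B * A)"
    using assms by (auto simp: mat_trace_def scalar_prod_def lessThan_atLeast0 intro!: sum.cong)
  finally show ?thesis .
qed

lemma mat_trace_transpose:
  assumes "A \<in> carrier_mat n n"
  shows "mat_trace (A\<^sup>T) = mat_trace A"
  using assms by (auto simp: mat_trace_def)

lemma mat_trace_add:
  assumes "A \<in> carrier_mat n n" "B \<in> carrier_mat n n"
  shows "mat_trace (A + B) = mat_trace A + mat_trace B"
  using assms by (auto simp: mat_trace_def sum.distrib)

text \<open>Back substitution: row i of \<open>A * Y = 1\<close> involves only rows i and below of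
  \<open>Y\<close>, so each column of \<open>Y\<close> is determined upwards from the last row. The
  diagonal claim is stated as a product because the entries will be power series, where nonzero does
  not mean invertible.\<close>

lemma upper_triangular_right_inverse:
  fixes A Y :: "'a :: idom mat"
  assumes A: "A \<in> carrier_mat n n" and Y: "Y \<in> carrier_mat n n"
    and ut: "upper_triangular A" and inv: "A * Y = 1\<^sub>m n"
    and nz: "\<And>i. i < n \<Longrightarrow> A $$ (i, i) \<noteq> 0"
  shows "upper_triangular Y" and "i < n \<Longrightarrow> A $$ (i, i) * Y $$ (i, i) = 1"
proof -
  have entry: "(\<Sum>k = i..<n. A $$ (i, k) * Y $$ (k, j)) = (if i = j then 1 else 0)"
    if "i < n" "j < n" for i j
  proof -
    have "(\<Sum>k = i..<n. A $$ (i, k) * Y $$ (k, j)) = (\<Sum>k = 0..<n. A $$ (i, k) * Y $$ (k, j))"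
      using ut A that by (intro sum.mono_neutral_left) (auto simp: upper_triangular_def)
    also have "\<dots> = (A * Y) $$ (i, j)"
      using A Y that by (simp add: scalar_prod_def)
    finally show ?thesis using inv that by simp
  qed
  have zero: "Y $$ (i, j) = 0" if "j < i" "i < n" for i j
    using that
  proof (induction "n - i" arbitrary: i rule: less_induct)
    case less
    have "A $$ (i, i) * Y $$ (i, j) + (\<Sum>k = Suc i..<n. A $$ (i, k) * Y $$ (k, j)) = 0"
      using entry[of i j] less.prems by (simp add: sum.atLeast_Suc_lessThan)
    moreover have "(\<Sum>k = Suc i..<n. A $$ (i, k) * Y $$ (k, j)) = 0"
      using less by (intro sum.neutral) auto
    ultimately show ?case using nz less.prems by simp
  qed
  show "upper_triangular Y" using zero Y by auto
  assume i: "i < n"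
  have "A $$ (i, i) * Y $$ (i, i) + (\<Sum>k = Suc i..<n. A $$ (i, k) * Y $$ (k, i)) = 1"
    using entry[of i i] i by (simp add: sum.atLeast_Suc_lessThan)
  moreover have "(\<Sum>k = Suc i..<n. A $$ (i, k) * Y $$ (k, i)) = 0"
    using zero by (intro sum.neutral) auto
  ultimately show "A $$ (i, i) * Y $$ (i, i) = 1" by simp
qed

lemma mat_trace_mult_upper_triangular:
  fixes A Y :: "'a :: comm_semiring_1 mat"
  assumes A: "A \<in> carrier_mat n n" and Y: "Y \<in> carrier_mat n n"
    and "upper_triangular A" "upper_triangular Y"
  shows "mat_trace (A * Y) = (\<Sum>i<n. A $$ (i, i) * Y $$ (i, i))"
proof -
  have "(\<Sum>k = 0..<n. A $$ (i, k) * Y $$ (k, i)) = A $$ (i, i) * Y $$ (i, i)" if "i < n" for i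
  proof -
    have "A $$ (i, k) * Y $$ (k, i) = 0" if "k \<noteq> i" "k < n" for k
      using assms that \<open>i < n\<close> by (cases "k < i") (auto simp: upper_triangular_def)
    then have "(\<Sum>k = 0..<n. A $$ (i, k) * Y $$ (k, i))
        = (\<Sum>k \<in> {i}. A $$ (i, k) * Y $$ (k, i))"
      using that by (intro sum.mono_neutral_right) auto
    then show ?thesis by simp
  qed
  then show ?thesis
    using A Y by (simp add: mat_trace_def scalar_prod_def)
qed

section \<open>Logarithmic derivative of a triangular factorization\<close>

lemma map_mat_fps_deriv_mult:
  fixes A B :: "'a :: comm_ring_1 fps mat"
  assumes "A \<in> carrier_mat m n" "B \<in> carrier_mat n k"
  shows "map_mat fps_deriv (A * B) = map_mat fps_deriv A * B + A * map_mat fps_deriv B"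
  using assms
  by (intro eq_matI) (auto simp: scalar_prod_def fps_deriv_sum sum.distrib algebra_simps)

text \<open>Jacobi's formula for the logarithmic derivative of a determinant, obtained without
  determinants. The product rule splits the trace into a \<open>U\<close> part and a
  \<open>V\<close> part, and each is the trace of a product of two upper triangular matrices, which
  sees only their diagonals. The lower factor is written \<open>V\<^sup>T\<close> so that the same
  triangular lemmas serve both parts.\<close>

lemma mat_trace_deriv_factorization:
  fixes R U V :: "'a :: idom fps mat"
  assumes R: "R \<in> carrier_mat n n" and U: "U \<in> carrier_mat n n" and V: "V \<in> carrier_mat n n"
    and utU: "upper_triangular U" and utV: "upper_triangular V"
    and unit: "\<And>i. i < n \<Longrightarrow> U $$ (i, i) = 1" and nz: "\<And>i. i < n \<Longrightarrow> V $$ (i, i) \<noteq> 0"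
    and left: "R * (U * V\<^sup>T) = 1\<^sub>m n" and right: "(U * V\<^sup>T) * R = 1\<^sub>m n"
    and G: "\<And>i. i < n \<Longrightarrow> fps_deriv (V $$ (i, i)) = G i * V $$ (i, i)"
  shows "mat_trace (R * map_mat fps_deriv (U * V\<^sup>T)) = (\<Sum>i<n. G i)"
proof -
  let ?D = "map_mat fps_deriv"
  have V': "V\<^sup>T \<in> carrier_mat n n" using V by simp
  have DU: "?D U \<in> carrier_mat n n" and DV: "?D V \<in> carrier_mat n n" using U V by auto
  \<comment> \<open>\<open>Y\<close> and \<open>Z\<close> are the right inverses of \<open>U\<close>
    and \<open>V\<close> that can be read off from \<open>R\<close>.\<close>
  define Y where "Y = V\<^sup>T * R"
  define Z where "Z = (R * U)\<^sup>T"
  have Y: "Y \<in> carrier_mat n n" and Z: "Z \<in> carrier_mat n n"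
    using R U V by (auto simp: Y_def Z_def)
  have UY: "U * Y = 1\<^sub>m n" using right assoc_mult_mat[OF U V' R] by (simp add: Y_def)
  have "R * U * V\<^sup>T = 1\<^sub>m n" using left assoc_mult_mat[OF R U V'] by simp
  then have VZ: "V * Z = 1\<^sub>m n"
    using transpose_mult[of "R * U" n n "V\<^sup>T" n] R U V' by (simp add: Z_def)
  have utDU: "upper_triangular (?D U)" and utDV: "upper_triangular (?D V)"
    using utU utV U V by (auto simp: upper_triangular_def)
  have nzU: "U $$ (i, i) \<noteq> 0" if "i < n" for i using unit that by simp
  \<comment> \<open>The diagonal of \<open>U\<close> is constantly 1, so its derivative has zero
    diagonal.\<close>
  have tU: "mat_trace (?D U * Y) = 0"
    using mat_trace_mult_upper_triangular[OF DU Y utDU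
        upper_triangular_right_inverse(1)[OF U Y utU UY nzU]] unit U
    by simp
  have "mat_trace (?D V * Z) = (\<Sum>i<n. ?D V $$ (i, i) * Z $$ (i, i))"
    by (rule mat_trace_mult_upper_triangular[OF DV Z utDV
        upper_triangular_right_inverse(1)[OF V Z utV VZ nz]])
  also have "\<dots> = (\<Sum>i<n. G i)"
  proof (rule sum.cong[OF refl])
    fix i assume "i \<in> {..<n}"
    then have i: "i < n" by simp
    have "?D V $$ (i, i) * Z $$ (i, i) = G i * (V $$ (i, i) * Z $$ (i, i))"
      using G[OF i] V i by simp
    then show "?D V $$ (i, i) * Z $$ (i, i) = G i"
      using upper_triangular_right_inverse(2)[OF V Z utV VZ nz i] by simp
  qed
  finally have tV: "mat_trace (?D V * Z) = (\<Sum>i<n. G i)" .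
  have DVT: "?D (V\<^sup>T) = (?D V)\<^sup>T" using V by (intro eq_matI) auto
  have "R * ?D (U * V\<^sup>T) = R * (?D U * V\<^sup>T) + R * (U * (?D V)\<^sup>T)"
    using R U V DU DV
    by (subst map_mat_fps_deriv_mult[OF U V']) (simp add: DVT mult_add_distrib_mat[of _ n n _ n])
  then have "mat_trace (R * ?D (U * V\<^sup>T))
      = mat_trace (R * (?D U * V\<^sup>T)) + mat_trace (R * (U * (?D V)\<^sup>T))"
    using mat_trace_add[of "R * (?D U * V\<^sup>T)" n "R * (U * (?D V)\<^sup>T)"] R U V by simp
  \<comment> \<open>Cyclicity of the trace moves \<open>R\<close> next to \<open>V\<^sup>T\<close>,
    which produces \<open>Y\<close>. The other summand needs only a transposition, since
    \<open>R * U\<close> is the transpose of \<open>Z\<close>.\<close>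
  also have "mat_trace (R * (?D U * V\<^sup>T)) = mat_trace (?D U * V\<^sup>T * R)"
    using R DU V' by (intro mat_trace_mult_comm[of _ n n]) auto
  also have "?D U * V\<^sup>T * R = ?D U * Y"
    using assoc_mult_mat[OF DU V' R] by (simp add: Y_def)
  also have "R * (U * (?D V)\<^sup>T) = (?D V * Z)\<^sup>T"
    using R U DV Z transpose_mult[OF DV Z] assoc_mult_mat[of R n n U n "(?D V)\<^sup>T" n]
    by (simp add: Z_def)
  also have "mat_trace ((?D V * Z)\<^sup>T) = mat_trace (?D V * Z)"
    using DV Z by (intro mat_trace_transpose) auto
  finally show ?thesis using tU tV by simp
qed

section \<open>The pencil A - x I and its power series inverse\<close>

definition fps_pencil :: "nat \<Rightarrow> 'a :: comm_ring_1 mat \<Rightarrow> 'a fps mat" where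
  "fps_pencil n A = mat n n (\<lambda>(i, j). fps_const (A $$ (i, j)) - (if i = j then fps_X else 0))"

definition fps_power_mat :: "nat \<Rightarrow> 'a :: comm_ring_1 mat \<Rightarrow> 'a fps mat" where
  "fps_power_mat n C = mat n n (\<lambda>(i, j). Abs_fps (\<lambda>p. (C ^\<^sub>m Suc p) $$ (i, j)))"

text \<open>Telescoping Neumann series: multiplying the sum of C^(p+1) x^p by A lowers each exponent
  by one, multiplying it by x shifts the coefficients by one, and the difference leaves only the
  identity at p = 0.\<close>

lemma
  fixes A C :: "'a :: comm_ring_1 mat"
  assumes A: "A \<in> carrier_mat n n" and C: "C \<in> carrier_mat n n"
    and AC: "A * C = 1\<^sub>m n" and CA: "C * A = 1\<^sub>m n"
  shows fps_pencil_mult_power_mat: "fps_pencil n A * fps_power_mat n C = 1\<^sub>m n"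
    and fps_power_mat_mult_pencil: "fps_power_mat n C * fps_pencil n A = 1\<^sub>m n"
proof -
  have Cp: "C ^\<^sub>m p \<in> carrier_mat n n" for p using C by simp
  \<comment> \<open>\<open>pow_mat\<close> appends factors on the right, so cancelling on the left
    takes an induction, while \<open>r\<close> is immediate.\<close>
  have l: "A * C ^\<^sub>m Suc p = C ^\<^sub>m p" for p
  proof (induction p)
    case 0
    then show ?case using A C AC by simp
  next
    case (Suc p)
    have "A * C ^\<^sub>m Suc (Suc p) = A * C ^\<^sub>m Suc p * C"
      using assoc_mult_mat[OF A Cp[of "Suc p"] C] by simp
    then show ?case by (simp only: Suc) simp
  qed
  have r: "C ^\<^sub>m Suc p * A = C ^\<^sub>m p" for p
    using assoc_mult_mat[OF Cp[of p] C A] CA right_mult_one_mat[OF Cp[of p]] by simp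
  show "fps_pencil n A * fps_power_mat n C = 1\<^sub>m n"
  proof (intro eq_matI fps_ext)
    fix i j p assume "i < dim_row (1\<^sub>m n :: 'a fps mat)" "j < dim_col (1\<^sub>m n :: 'a fps mat)"
    then have ij: "i < n" "j < n" by auto
    have "(fps_pencil n A * fps_power_mat n C) $$ (i, j)
        = (\<Sum>k = 0..<n. fps_const (A $$ (i, k)) * Abs_fps (\<lambda>p. (C ^\<^sub>m Suc p) $$ (k, j))
          - (if k = i then fps_X * Abs_fps (\<lambda>p. (C ^\<^sub>m Suc p) $$ (k, j)) else 0))"
      using ij by (auto simp: fps_pencil_def fps_power_mat_def scalar_prod_def left_diff_distrib
          intro!: sum.cong simp del: pow_mat.simps)
    also have "\<dots> = (\<Sum>k = 0..<n. fps_const (A $$ (i, k)) * Abs_fps (\<lambda>p. (C ^\<^sub>m Suc p) $$ (k, j)))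
          - fps_X * Abs_fps (\<lambda>p. (C ^\<^sub>m Suc p) $$ (i, j))"
      using ij by (simp add: sum_subtractf del: pow_mat.simps)
    also have "fps_nth \<dots> p = (A * C ^\<^sub>m Suc p) $$ (i, j)
        - (if p = 0 then 0 else (C ^\<^sub>m p) $$ (i, j))"
      using A Cp[of "Suc p"] ij C
      by (cases p) (auto simp: fps_sum_nth scalar_prod_def simp del: pow_mat.simps)
    also have "\<dots> = fps_nth (1\<^sub>m n $$ (i, j)) p"
      using ij C by (subst l) (auto)
    finally show "fps_nth ((fps_pencil n A * fps_power_mat n C) $$ (i, j)) p
        = fps_nth (1\<^sub>m n $$ (i, j)) p" .
  qed (auto simp: fps_pencil_def fps_power_mat_def)
  show "fps_power_mat n C * fps_pencil n A = 1\<^sub>m n"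
  proof (intro eq_matI fps_ext)
    fix i j p assume "i < dim_row (1\<^sub>m n :: 'a fps mat)" "j < dim_col (1\<^sub>m n :: 'a fps mat)"
    then have ij: "i < n" "j < n" by auto
    have "(fps_power_mat n C * fps_pencil n A) $$ (i, j)
        = (\<Sum>k = 0..<n. Abs_fps (\<lambda>p. (C ^\<^sub>m Suc p) $$ (i, k)) * fps_const (A $$ (k, j))
          - (if k = j then Abs_fps (\<lambda>p. (C ^\<^sub>m Suc p) $$ (i, k)) * fps_X else 0))"
      using ij by (auto simp: fps_pencil_def fps_power_mat_def scalar_prod_def right_diff_distrib
          intro!: sum.cong simp del: pow_mat.simps)
    also have "\<dots> = (\<Sum>k = 0..<n. Abs_fps (\<lambda>p. (C ^\<^sub>m Suc p) $$ (i, k)) * fps_const (A $$ (k, j)))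
          - Abs_fps (\<lambda>p. (C ^\<^sub>m Suc p) $$ (i, j)) * fps_X"
      using ij by (simp add: sum_subtractf del: pow_mat.simps)
    also have "fps_nth \<dots> p = (C ^\<^sub>m Suc p * A) $$ (i, j)
        - (if p = 0 then 0 else (C ^\<^sub>m p) $$ (i, j))"
      using A Cp[of "Suc p"] ij C
      by (cases p) (auto simp: fps_sum_nth scalar_prod_def simp del: pow_mat.simps)
    also have "\<dots> = fps_nth (1\<^sub>m n $$ (i, j)) p"
      using ij C by (subst r) (auto)
    finally show "fps_nth ((fps_power_mat n C * fps_pencil n A) $$ (i, j)) p
        = fps_nth (1\<^sub>m n $$ (i, j)) p" .
  qed (auto simp: fps_pencil_def fps_power_mat_def)
qed

text \<open>The entries of \<open>A\<close> are constant series, so the pencil has derivative -I and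
  the product is the negated power series inverse.\<close>

lemma mat_trace_power_eq:
  fixes C :: "'a :: comm_ring_1 mat"
  assumes "C \<in> carrier_mat n n"
  shows "mat_trace (C ^\<^sub>m Suc p)
    = - fps_nth (mat_trace (fps_power_mat n C * map_mat fps_deriv (fps_pencil n A))) p"
proof -
  have "map_mat fps_deriv (fps_pencil n A) = - 1\<^sub>m n"
    by (intro eq_matI) (auto simp: fps_pencil_def)
  then have "fps_power_mat n C * map_mat fps_deriv (fps_pencil n A) = - fps_power_mat n C"
    by (simp add: fps_power_mat_def)
  moreover have "dim_row (C ^\<^sub>m Suc p) = n"
    using pow_carrier_mat[OF assms, of "Suc p"] by blast
  ultimately show ?thesis
    by (simp add: mat_trace_def fps_power_mat_def fps_sum_nth sum_negf del: pow_mat.simps)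
qed

section \<open>Bidiagonal matrices and their tridiagonal products\<close>

definition bidiag :: "nat \<Rightarrow> (nat \<Rightarrow> 'a) \<Rightarrow> (nat \<Rightarrow> 'a) \<Rightarrow> 'a :: zero mat" where
  "bidiag n a b = mat n n (\<lambda>(i, j). if j = i then a i else if j = Suc i then b i else 0)"

lemma bidiag_carrier [simp]: "bidiag n a b \<in> carrier_mat n n"
  by (simp add: bidiag_def)

lemma upper_triangular_bidiag: "upper_triangular (bidiag n a b)"
  by (auto simp: bidiag_def)

lemma bidiag_diag: "i < n \<Longrightarrow> bidiag n a b $$ (i, i) = a i"
  by (simp add: bidiag_def)

lemma bidiag_mult_transpose:
  fixes a b c d :: "nat \<Rightarrow> 'a :: comm_semiring_1"
  shows "bidiag n a b * (bidiag n c d)\<^sup>T = mat n n (\<lambda>(i, j).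
     if j = i then a i * c i + (if Suc i < n then b i * d i else 0)
     else if j = Suc i then b i * c j
     else if i = Suc j then a i * d j else 0)" (is "_ = ?R")
proof (rule eq_matI)
  fix i j assume "i < dim_row ?R" "j < dim_col ?R"
  then have ij: "i < n" "j < n" by auto
  let ?t = "\<lambda>k. bidiag n a b $$ (i, k) * bidiag n c d $$ (j, k)"
  have "(bidiag n a b * (bidiag n c d)\<^sup>T) $$ (i, j) = (\<Sum>k = 0..<n. ?t k)"
    using ij by (simp add: scalar_prod_def bidiag_def)
  \<comment> \<open>Row i is supported in columns i and i + 1; the last row has no second column,
    hence the condition \<open>Suc i < n\<close> on the diagonal.\<close>
  also have "\<dots> = (\<Sum>k \<in> {i, Suc i} \<inter> {0..<n}. ?t k)"
    using ij by (intro sum.mono_neutral_right) (auto simp: bidiag_def)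
  also have "{i, Suc i} \<inter> {0..<n} = (if Suc i < n then {i, Suc i} else {i})"
    using ij by auto
  finally show "(bidiag n a b * (bidiag n c d)\<^sup>T) $$ (i, j) = ?R $$ (i, j)"
    using ij by (auto simp: bidiag_def)
qed (auto simp: bidiag_def)

section \<open>Exponential generating functions of the recurrences\<close>

definition egf :: "(nat \<Rightarrow> real) \<Rightarrow> real fps" where
  "egf a = Abs_fps (\<lambda>p. if p = 0 then 0 else a p / fact p)"

lemma egf_nth_0 [simp]: "fps_nth (egf a) 0 = 0"
  by (simp add: egf_def)

lemma egf_nth: "p > 0 \<Longrightarrow> fps_nth (egf a) p = a p / fact p"
  by (simp add: egf_def)

text \<open>Binomial convolution. \<open>egf\<close> has constant coefficient zero whatever
  \<open>a 0\<close> and \<open>b 0\<close> are, which removes the terms k = 0 and k = p.\<close>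

lemma egf_mult_nth:
  "fps_nth (egf b * egf a) p = (\<Sum>k = 1..p - 1. real (p choose k) * b k * a (p - k)) / fact p"
proof -
  have "fps_nth (egf b * egf a) p = (\<Sum>k = 0..p. fps_nth (egf b) k * fps_nth (egf a) (p - k))"
    by (rule fps_mult_nth)
  also have "\<dots> = (\<Sum>k = 1..p - 1. fps_nth (egf b) k * fps_nth (egf a) (p - k))"
    by (intro sum.mono_neutral_right) (auto simp: egf_def)
  also have "\<dots> = (\<Sum>k = 1..p - 1. real (p choose k) * b k * a (p - k) / fact p)"
    by (intro sum.cong) (auto simp: egf_nth binomial_fact field_simps)
  finally show ?thesis by (simp add: sum_divide_distrib)
qed

text \<open>Here \<open>a\<close> is row i of h and \<open>b\<close> is row i + 1. The sum in the
  recurrence lacks the term k = p - 1 of the full convolution, namely p b(p-1) a(1). Since a(1) = F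
  b(1) + 1/q, the extra product in the recurrence supplies this term up to p b(p-1) / q, a
  coefficient of x/q times \<open>egf b\<close>. Dividing by \<open>1 - egf b\<close> would give a
  continued fraction step.\<close>

lemma egf_pivot_recurrence:
  fixes a b :: "nat \<Rightarrow> real"
  assumes a1: "a 1 = F * b 1 + 1 / q" and q: "q \<noteq> 0"
    and rec: "\<And>p. p \<ge> 2 \<Longrightarrow> a p = F * (b p + real p * b 1 * b (p - 1))
                 + (\<Sum>k = 1..p - 2. real (p choose k) * b k * a (p - k))"
  shows "egf a * (1 - egf b) = fps_const (1 / q) * fps_X * (1 - egf b) + fps_const F * egf b"
proof -
  have "egf a = fps_const (1 / q) * fps_X + fps_const F * egf b
      + (egf b * egf a - fps_const (1 / q) * (fps_X * egf b))"
  proof (rule fps_ext)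
    fix p :: nat
    consider "p = 0" | "p = 1" | "p \<ge> 2" by linarith
    then show "fps_nth (egf a) p = fps_nth (fps_const (1 / q) * fps_X + fps_const F * egf b
      + (egf b * egf a - fps_const (1 / q) * (fps_X * egf b))) p"
    proof cases
      case 3
      then obtain m where p: "p = Suc (Suc m)"
        by (metis Suc_diff_Suc Suc_1 diff_zero less_eq_Suc_le add_2_eq_Suc le_Suc_ex)
      have split: "(\<Sum>k = 1..p - 1. real (p choose k) * b k * a (p - k))
          = (\<Sum>k = 1..p - 2. real (p choose k) * b k * a (p - k)) + real p * b (p - 1) * a 1"
        using p by simp
      have "a p = F * b p + (\<Sum>k = 1..p - 1. real (p choose k) * b k * a (p - k))
          - real p * b (p - 1) / q"
        unfolding split rec[OF 3] a1 by (simp add: algebra_simps)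
      \<comment> \<open>Dividing by p! absorbs the factor p, so this is the shifted coefficient that
        multiplication by x produces.\<close>
      moreover have shift: "real p * b (p - 1) / q / fact p = 1 / q * (b (p - 1) / fact (p - 1))"
        using p fact_reduce[of p, where 'a = real] by simp
      ultimately have "a p / fact p = F * (b p / fact p)
          + (\<Sum>k = 1..p - 1. real (p choose k) * b k * a (p - k)) / fact p
          - 1 / q * (b (p - 1) / fact (p - 1))"
        using shift by (simp add: add_divide_distrib diff_divide_distrib)
      moreover have "fps_nth (fps_const (1 / q) * fps_X :: real fps) p = 0"
        using p by simp
      moreover have "fps_nth (fps_X * egf b) p = b (p - 1) / fact (p - 1)"
        using p by (simp add: egf_nth)
      ultimately show ?thesis
        using p by (simp only: fps_add_nth fps_sub_nth fps_mult_left_const_nth egf_mult_nth)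
          (simp add: egf_nth)
    qed (use a1 in \<open>auto simp: egf_nth egf_mult_nth\<close>)
  qed
  then show ?thesis by (simp add: algebra_simps)
qed

text \<open>With g = \<open>egf a\<close> and G the series on the right, the recurrence for
  \<open>c\<close> at index p + 1 is the coefficient of x^p in G = g' + g G. Thus G is g' / (1 - g),
  in a form free of division.\<close>

lemma egf_log_derivative:
  fixes a c :: "nat \<Rightarrow> real"
  assumes c1: "c 1 = a 1"
    and rec: "\<And>p. p \<ge> 2 \<Longrightarrow> c p = a p + (\<Sum>k = 1..p - 1. real ((p - 1) choose k) * a k * c (p - k))"
  shows "fps_deriv (egf a) = Abs_fps (\<lambda>p. c (Suc p) / fact p) * (1 - egf a)"
proof -
  let ?G = "Abs_fps (\<lambda>p. c (Suc p) / fact p)"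
  have "?G = fps_deriv (egf a) + egf a * ?G"
  proof (rule fps_ext)
    fix p
    \<comment> \<open>At p = 0 the sum is empty and this is \<open>c1\<close>.\<close>
    have c: "c (Suc p) = a (Suc p) + (\<Sum>k = 1..p. real (p choose k) * a k * c (Suc p - k))"
      using c1 rec[of "Suc p"] by (cases p) auto
    have "fps_nth (egf a * ?G) p = (\<Sum>k = 0..p. fps_nth (egf a) k * fps_nth ?G (p - k))"
      by (rule fps_mult_nth)
    also have "\<dots> = (\<Sum>k = 1..p. fps_nth (egf a) k * fps_nth ?G (p - k))"
      by (intro sum.mono_neutral_right) (auto simp: egf_def)
    also have "\<dots> = (\<Sum>k = 1..p. real (p choose k) * a k * c (Suc p - k) / fact p)"
      by (intro sum.cong) (auto simp: egf_nth binomial_fact field_simps Suc_diff_le)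
    finally have "fps_nth (egf a * ?G) p
        = (\<Sum>k = 1..p. real (p choose k) * a k * c (Suc p - k)) / fact p"
      by (simp add: sum_divide_distrib)
    moreover have "fps_nth (fps_deriv (egf a)) p = a (Suc p) / fact p"
      by (simp add: egf_nth field_simps del: of_nat_Suc)
    ultimately show "fps_nth ?G p = fps_nth (fps_deriv (egf a) + egf a * ?G) p"
      using c by (simp add: add_divide_distrib)
  qed
  then show ?thesis by (simp add: algebra_simps)
qed

section \<open>Factorization of the pencil of B B^T and the trace formula\<close>

lemma upper_bidiagonal_eq_bidiag:
  "upper_bidiagonal N q e = bidiag N (\<lambda>i. sqrt (q (Suc i))) (\<lambda>i. sqrt (e (Suc i)))"
  by (intro eq_matI) (auto simp: upper_bidiagonal_def bidiag_def)

text \<open>Elimination from the last row upwards with pivots d_i = q_i (1 - g_i). The off-diagonal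
  entries of B B^T are the numbers \<open>s\<close>, so the diagonal demands d_i + s_i^2 / d_(i+1) =
  q_i + e_i - x, where s_i^2 = e_i q_(i+1). This is the recurrence \<open>gi\<close> after division
  by 1 - g_(i+1), and it starts from d_N = q_N - x. Matrix position i carries sequence index
  \<open>Suc i\<close>.\<close>

lemma fps_pencil_factorization:
  fixes q e :: "nat \<Rightarrow> real" and g :: "nat \<Rightarrow> real fps"
  assumes q: "\<And>i. i \<in> {1..N} \<Longrightarrow> q i > 0" and e: "\<And>i. i \<in> {1..N - 1} \<Longrightarrow> e i > 0"
    and g0: "\<And>i. fps_nth (g i) 0 = 0"
    and gN: "g N = fps_const (1 / q N) * fps_X"
    and gi: "\<And>i. i \<in> {1..N - 1} \<Longrightarrow> g i * (1 - g (Suc i))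
      = fps_const (1 / q i) * fps_X * (1 - g (Suc i)) + fps_const (e i / q i) * g (Suc i)"
    and B: "B = upper_bidiagonal N q e"
    and s: "s = (\<lambda>i. sqrt (e (Suc i)) * sqrt (q (Suc (Suc i))))"
  shows "fps_pencil N (B * B\<^sup>T)
    = bidiag N (\<lambda>_. 1) (\<lambda>i. fps_const (s i / q (Suc (Suc i))) * inverse (1 - g (Suc (Suc i))))
      * (bidiag N (\<lambda>i. fps_const (q (Suc i)) * (1 - g (Suc i))) (\<lambda>i. fps_const (s i)))\<^sup>T"
    (is "_ = ?UL")
proof (rule eq_matI)
  fix i j assume "i < dim_row ?UL" "j < dim_col ?UL"
  then have ij: "i < N" "j < N" by (auto simp: bidiag_def)
  have inv: "inverse (1 - g k) * (1 - g k) = 1" for k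
    by (rule inverse_mult_eq_1) (simp add: g0)
  consider "j = i" "Suc i < N" | "j = i" "Suc i = N" | "j = Suc i" | "i = Suc j"
    | "j \<noteq> i" "j \<noteq> Suc i" "i \<noteq> Suc j"
    using ij by linarith
  then show "fps_pencil N (B * B\<^sup>T) $$ (i, j) = ?UL $$ (i, j)"
  proof cases
    case 1
    let ?r = "1 - g (Suc i)" and ?r' = "1 - g (Suc (Suc i))"
    have pos: "q (Suc i) > 0" "q (Suc (Suc i)) > 0" "e (Suc i) > 0"
      using q e 1 by auto
    have ss: "s i / q (Suc (Suc i)) * s i = e (Suc i)"
      using pos by (simp add: s field_simps)
    have gi': "g (Suc i) * ?r' = fps_const (1 / q (Suc i)) * fps_X * ?r'
        + fps_const (e (Suc i) / q (Suc i)) * g (Suc (Suc i))"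
      using 1 by (intro gi) auto
    have "fps_const (q (Suc i)) * (g (Suc i) * ?r')
        = fps_X * ?r' + fps_const (e (Suc i)) * g (Suc (Suc i))"
    proof -
      have k: "fps_const (q (Suc i)) * fps_const (1 / q (Suc i)) = 1"
        "fps_const (q (Suc i)) * fps_const (e (Suc i) / q (Suc i)) = fps_const (e (Suc i))"
        using pos by simp_all
      have "fps_const (q (Suc i)) * (g (Suc i) * ?r')
        = fps_const (q (Suc i)) * fps_const (1 / q (Suc i)) * (fps_X * ?r')
          + fps_const (q (Suc i)) * fps_const (e (Suc i) / q (Suc i)) * g (Suc (Suc i))"
        unfolding gi' by (simp only: distrib_left mult.assoc)
      then show ?thesis unfolding k by simp
    qed
    \<comment> \<open>The pivot equation with denominator cleared: writing the last g as 1 -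
      \<open>?r'\<close> splits its term into the constant e and a multiple of
      \<open>?r'\<close>.\<close>
    then have "fps_const (q (Suc i)) * ?r * ?r' + fps_const (e (Suc i))
        = (fps_const (q (Suc i)) + fps_const (e (Suc i)) - fps_X) * ?r'"
      by (simp add: algebra_simps del: fps_const_add)
    then have "(fps_const (q (Suc i)) * ?r * ?r' + fps_const (e (Suc i))) * inverse ?r'
        = (fps_const (q (Suc i)) + fps_const (e (Suc i)) - fps_X) * ?r' * inverse ?r'"
      by (simp only:)
    then have "fps_const (q (Suc i)) * ?r * (inverse ?r' * ?r') + fps_const (e (Suc i)) * inverse ?r'
        = (fps_const (q (Suc i)) + fps_const (e (Suc i)) - fps_X) * (inverse ?r' * ?r')"
      by (simp only: distrib_right distrib_left mult_ac)
    then have "fps_const (q (Suc i)) * ?r + fps_const (e (Suc i)) * inverse ?r'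
        = fps_const (q (Suc i)) + fps_const (e (Suc i)) - fps_X"
      by (simp add: inv)
    moreover have "fps_const (s i / q (Suc (Suc i))) * inverse ?r' * fps_const (s i)
        = fps_const (e (Suc i)) * inverse ?r'"
      unfolding ss[symmetric] by (simp add: mult_ac)
    ultimately have "fps_const (q (Suc i)) * ?r
        + fps_const (s i / q (Suc (Suc i))) * inverse ?r' * fps_const (s i)
        = fps_const (q (Suc i)) + fps_const (e (Suc i)) - fps_X"
      by (simp only:)
    then show ?thesis
      using 1 pos by (simp add: fps_pencil_def B upper_bidiagonal_eq_bidiag bidiag_mult_transpose
          del: fps_const_add add: fps_const_add[symmetric])
  next
    case 2
    then have "q N > 0" using q by auto
    moreover have "fps_const (q N) * (fps_const (1 / q N) * fps_X) = fps_X"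
      using \<open>q N > 0\<close> by (simp add: mult.assoc[symmetric])
    ultimately show ?thesis
      using 2 by (simp add: fps_pencil_def B upper_bidiagonal_eq_bidiag bidiag_mult_transpose gN
          right_diff_distrib)
  next
    case 3
    then have "q (Suc (Suc i)) > 0" using q ij by auto
    then have k: "fps_const (s i / q (Suc (Suc i))) * fps_const (q (Suc (Suc i))) = fps_const (s i)"
      by simp
    \<comment> \<open>The superdiagonal of the left factor is s divided by the next pivot, and that
      pivot cancels.\<close>
    have "fps_const (s i / q (Suc (Suc i))) * inverse (1 - g (Suc (Suc i)))
        * (fps_const (q (Suc (Suc i))) * (1 - g (Suc (Suc i))))
        = (fps_const (s i / q (Suc (Suc i))) * fps_const (q (Suc (Suc i))))
          * (inverse (1 - g (Suc (Suc i))) * (1 - g (Suc (Suc i))))"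
      by (simp only: mult_ac)
    also have "\<dots> = fps_const (s i)"
      unfolding k inv by simp
    finally show ?thesis
      using 3 ij by (simp add: fps_pencil_def B upper_bidiagonal_eq_bidiag bidiag_mult_transpose s)
  next
    case 4
    then show ?thesis
      using ij by (simp add: fps_pencil_def B upper_bidiagonal_eq_bidiag bidiag_mult_transpose s
          mult.commute)
  next
    case 5
    then show ?thesis
      using ij by (simp add: fps_pencil_def B upper_bidiagonal_eq_bidiag bidiag_mult_transpose)
  qed
qed (auto simp: fps_pencil_def bidiag_def)

text \<open>det B is the product of the sqrt q_i, hence nonzero, and det (B B^T) is its
  square.\<close>

lemma mat_inverse_upper_bidiagonal:
  assumes q: "\<And>i. i \<in> {1..N} \<Longrightarrow> q i > 0" and B: "B = upper_bidiagonal N q e"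
  obtains C where "mat_inverse (B * B\<^sup>T) = Some C"
proof -
  have Bc: "B \<in> carrier_mat N N" by (simp add: B upper_bidiagonal_def)
  have "upper_triangular B"
    by (simp add: B upper_bidiagonal_eq_bidiag upper_triangular_bidiag del: upper_triangular_def)
  then have "det B = prod_list (diag_mat B)"
    using Bc by (rule det_upper_triangular)
  moreover have "q (Suc i) \<noteq> 0" if "i < N" for i
    using q[of "Suc i"] that by auto
  then have "0 \<notin> set (diag_mat B)"
    by (auto simp: diag_mat_def B upper_bidiagonal_def)
  ultimately have "det (B * B\<^sup>T) \<noteq> 0"
    using Bc by (simp add: det_mult[of _ N] det_transpose[of _ N] prod_list_zero_iff)
  then have "B * B\<^sup>T \<in> Units (ring_mat TYPE(real) N undefined)"
    using Bc by (intro det_non_zero_imp_unit) auto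
  then have "mat_inverse (B * B\<^sup>T) \<noteq> None"
    using mat_inverse(1)[of "B * B\<^sup>T" N undefined] Bc by auto
  then show ?thesis using that by blast
qed

theorem theorem2p9:
  fixes N :: nat
    and q e F :: "nat \<Rightarrow> real"
    and h H :: "nat \<Rightarrow> nat \<Rightarrow> real"
    and B :: "real mat"
  assumes "N \<ge> 1"
    and "\<And>i. i \<in> {1..N} \<Longrightarrow> q i > 0"
    and "\<And>i. i \<in> {1..N - 1} \<Longrightarrow> e i > 0"
    and "B = upper_bidiagonal N q e"
    and "\<And>i. i \<in> {1..N - 1} \<Longrightarrow> F i = e i / q i"
    and "h N 1 = 1 / q N"
    and "\<And>i. i \<in> {1..N - 1} \<Longrightarrow> h i 1 = F i * h (i + 1) 1 + 1 / q i"
    and "\<And>p. p \<ge> 2 \<Longrightarrow> h N p = 0"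
    and "\<And>i p. i \<in> {1..N - 1} \<Longrightarrow> p \<ge> 2 \<Longrightarrow>
           h i p = F i * (h (i + 1) p + real p * h (i + 1) 1 * h (i + 1) (p - 1))
                 + (\<Sum>k = 1..p - 2. real (p choose k) * h (i + 1) k * h i (p - k))"
    and "\<And>i. i \<in> {1..N} \<Longrightarrow> H i 1 = h i 1"
    and "\<And>i p. i \<in> {1..N} \<Longrightarrow> p \<ge> 2 \<Longrightarrow>
           H i p = h i p + (\<Sum>k = 1..p - 1. real ((p - 1) choose k) * h i k * H i (p - k))"
  shows "\<exists>C. mat_inverse (B * B\<^sup>T) = Some C \<and>
           (\<forall>p\<ge>1. mat_trace (C ^\<^sub>m p) = 1 / fact (p - 1) * (\<Sum>i = 1..N. H i p))"
proof -
  note q = assms(2) and B = assms(4)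
  define g where "g i = egf (h i)" for i
  define s where "s = (\<lambda>i. sqrt (e (Suc i)) * sqrt (q (Suc (Suc i))))"
  \<comment> \<open>The recurrence for H makes \<open>G i\<close> the series g_i' / (1 -
    g_i).\<close>
  define G where "G i = Abs_fps (\<lambda>p. H i (Suc p) / fact p)" for i
  define U where "U = bidiag N (\<lambda>_. 1)
    (\<lambda>i. fps_const (s i / q (Suc (Suc i))) * inverse (1 - g (Suc (Suc i))))"
  define V where "V = bidiag N (\<lambda>i. fps_const (q (Suc i)) * (1 - g (Suc i))) (\<lambda>i. fps_const (s i))"
  have g0: "fps_nth (g i) 0 = 0" for i by (simp add: g_def)
  have gN: "g N = fps_const (1 / q N) * fps_X"
    unfolding g_def
  proof (rule fps_ext)
    fix p :: nat
    consider "p = 0" | "p = 1" | "p \<ge> 2" by linarith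
    then show "fps_nth (egf (h N)) p = fps_nth (fps_const (1 / q N) * fps_X) p"
      using assms(6,8) by cases (auto simp: egf_nth)
  qed
  have gi: "g i * (1 - g (Suc i))
      = fps_const (1 / q i) * fps_X * (1 - g (Suc i)) + fps_const (e i / q i) * g (Suc i)"
    if "i \<in> {1..N - 1}" for i
    unfolding g_def
  proof (rule egf_pivot_recurrence)
    have "i \<in> {1..N}" using that by auto
    then show "q i \<noteq> 0" using q by force
    show "h i 1 = e i / q i * h (Suc i) 1 + 1 / q i"
      using assms(5,7)[OF that] by simp
    show "h i p = e i / q i * (h (Suc i) p + real p * h (Suc i) 1 * h (Suc i) (p - 1))
        + (\<Sum>k = 1..p - 2. real (p choose k) * h (Suc i) k * h i (p - k))" if "p \<ge> 2" for p
      using assms(9)[OF \<open>i \<in> {1..N - 1}\<close> that] assms(5)[OF \<open>i \<in> {1..N - 1}\<close>] by simp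
  qed
  have factor: "fps_pencil N (B * B\<^sup>T) = U * V\<^sup>T"
    unfolding U_def V_def
    by (rule fps_pencil_factorization[OF assms(2,3) g0 gN gi B s_def])
  \<comment> \<open>The constant q drops out of the logarithmic derivative of q (1 - g), leaving -G;
    this sign later cancels the one in \<open>mat_trace_power_eq\<close>.\<close>
  have GV: "fps_deriv (V $$ (i, i)) = - G (Suc i) * V $$ (i, i)" if "i < N" for i
  proof -
    have "fps_deriv (g (Suc i)) = G (Suc i) * (1 - g (Suc i))"
      unfolding g_def G_def using assms(10,11) that by (intro egf_log_derivative) auto
    then show ?thesis
      using that by (simp add: V_def bidiag_diag)
  qed
  have nzV: "V $$ (i, i) \<noteq> 0" if "i < N" for i
  proof -
    have "fps_nth (V $$ (i, i)) 0 = q (Suc i)"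
      using that by (simp add: V_def bidiag_diag g0)
    moreover have "q (Suc i) > 0" using q that by auto
    ultimately show ?thesis by force
  qed
  obtain C where C: "mat_inverse (B * B\<^sup>T) = Some C"
    by (rule mat_inverse_upper_bidiagonal[OF q B])
  have "B \<in> carrier_mat N N" by (simp add: B upper_bidiagonal_def)
  then have A: "B * B\<^sup>T \<in> carrier_mat N N" by simp
  from mat_inverse(2)[OF A C]
  have AC: "B * B\<^sup>T * C = 1\<^sub>m N" and CA: "C * (B * B\<^sup>T) = 1\<^sub>m N" and Cc: "C \<in> carrier_mat N N"
    by auto
  have tr: "mat_trace (fps_power_mat N C * map_mat fps_deriv (fps_pencil N (B * B\<^sup>T)))
      = (\<Sum>i<N. - G (Suc i))"
    unfolding factor
  proof (rule mat_trace_deriv_factorization)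
    show "fps_power_mat N C \<in> carrier_mat N N" by (simp add: fps_power_mat_def)
    show "fps_power_mat N C * (U * V\<^sup>T) = 1\<^sub>m N" "U * V\<^sup>T * fps_power_mat N C = 1\<^sub>m N"
      using fps_power_mat_mult_pencil[OF A Cc AC CA] fps_pencil_mult_power_mat[OF A Cc AC CA]
      by (simp_all add: factor)
  qed (use GV nzV in \<open>simp_all add: U_def V_def upper_triangular_bidiag bidiag_diag
      del: upper_triangular_def\<close>)
  have "mat_trace (C ^\<^sub>m p) = 1 / fact (p - 1) * (\<Sum>i = 1..N. H i p)" if "1 \<le> p" for p
  proof -
    obtain m where p: "p = Suc m" using \<open>1 \<le> p\<close> by (cases p) auto
    \<comment> \<open>The trace of C^p is the coefficient of x^(p-1), hence the factorial of p -
      1.\<close>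
    have "mat_trace (C ^\<^sub>m p) = (\<Sum>i<N. H (Suc i) p / fact m)"
      unfolding p mat_trace_power_eq[OF Cc, of m "B * B\<^sup>T"] tr
      by (simp add: fps_sum_nth G_def sum_negf)
    also have "\<dots> = (\<Sum>i = 1..N. H i p / fact m)"
      by (rule sum.reindex_bij_witness[of _ "\<lambda>i. i - 1" Suc]) auto
    finally show ?thesis
      by (simp add: p sum_divide_distrib)
  qed
  with C show ?thesis by blast
qed

end
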